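(* Let $\mathbf H^\infty$ be the hyperbolic space of countably infinite dimension, let $p\in(0,\infty)$, and let $(Y,d_Y)$ be an infrasup-umbel $p$-convex metric space. Then the compression rate of any coarse embedding of $\mathbf H^\infty$ into $Y$ satisfies $$\int_1^\infty\Big(\frac{\rho(t)}t\Big)^p\frac{dt}t<\infty ;$$ that is, whenever $f\colon\mathbf H^\infty\to Y$ and $\rho,\omega\colon[0,\infty)\to[0,\infty)$ are non-decreasing with $\lim_{t\to\infty}\rho(t)=\infty$ and $\rho(d(x,y))\le d_Y(f(x),f(y))\le\omega(d(x,y))$ for all $x,y\in\mathbf H^\infty$, the integral is finite. In particular, $\mathsf c_Y(\mathbf H^\infty)=\infty$.
   Context: **Hyperbolic space.** $\mathbf H^\infty$ is the (separable) infinite-dimensional real hyperbolic space, e.g. the hyperboloid model $\{(x_0,x)\in\mathbb R\times\ell_2: x_0^2-\|x\|^2=1,\ x_0>0\}$ with $\cosh d((x_0,x),(y_0,y))=x_0y_0-\langle x,y\rangle$. **Distortion.** For metric spaces, $\mathsf c_Y(X)$ is the infimum of all $D$ for which there are $s>0$ and $f\colon X\to Y$ with $s\,d_X(x,y)\le d_Y(f(x),f(y))\le sD\,d_X(x,y)$ for all $x,y\in X$ ($=\infty$ if there is no such $D$). **Notation.** $\mathbb N=\{1,2,\dots\}$. $[\mathbb N]^{h}$ (resp. $[\mathbb N]^{\le h}$) is the set of subsets of $\mathbb N$ of size exactly $h$ (resp. at most $h$), whose elements are written as increasing tuples. $(\bar n,i,\bar m)$ denotes concatenation, and "$(\bar n,i,\bar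 m)\in[\mathbb N]^{\le h}$" means that the concatenated tuple is strictly increasing and of length at most $h$. $\mathsf T^\omega_h$ is the countably branching tree of height $h$: vertex set $[\mathbb N]^{\le h}$, edges between $(n_1,\dots,n_i)$ and $(n_1,\dots,n_i,n_{i+1})$, with the shortest path metric. **Infrasup-umbel $p$-convexity.** A metric space $(M,d)$ is infrasup-umbel $p$-convex if there is $C>0$ such that for all $k\ge1$ and all $f\colon\mathsf T^\omega_{2^k}\to M$, $$\sum_{s=1}^{k-1}\ \inf_{\bar n\in[\mathbb N]^{\le 2^k-2^s}}\ \inf_{i\ne j\in\mathbb N}\ \inf_{\substack{\bar m,\bar m'\in[\mathbb N]^{2^s-1}:\\(\bar n,i,\bar m),(\bar n,j,\bar m')\in[\mathbb N]^{\le2^k}}}\frac{d(f(\bar n,i,\bar m),f(\bar n,j,\bar m'))^p}{2^{sp}}\le C^p\,\mathrm{Lip}(f)^p,$$ where $\mathrm{Lip}(f)$ is the Lipschitz constant of $f$ and an infimum over the empty set is $+\infty$. *)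

theory Defs
  imports "HOL-Analysis.Analysis"
begin

definition ell2 :: "(nat \<Rightarrow> real) set" where
  "ell2 = {x. summable (\<lambda>i. (x i)\<^sup>2)}"

definition ell2_inner :: "(nat \<Rightarrow> real) \<Rightarrow> (nat \<Rightarrow> real) \<Rightarrow> real" where
  "ell2_inner x y = (\<Sum>i. x i * y i)"

definition ell2_norm :: "(nat \<Rightarrow> real) \<Rightarrow> real" where
  "ell2_norm x = sqrt (ell2_inner x x)"

definition hyp_space :: "(real \<times> (nat \<Rightarrow> real)) set" where
  "hyp_space = {(x0, x). x \<in> ell2 \<and> x0\<^sup>2 - (ell2_norm x)\<^sup>2 = 1 \<and> x0 > 0}"

text \<open>On \<open>hyp_space\<close> the argument of \<^const>\<open>arcosh\<close> is at least 1, so this is the unique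
  nonnegative solution \<open>d\<close> of \<open>cosh d = x0 y0 - \<langle>x, y\<rangle>\<close>; see \<open>hyp_dist_nonneg\<close> and
  \<open>cosh_hyp_dist\<close> below.\<close>

definition hyp_dist :: "real \<times> (nat \<Rightarrow> real) \<Rightarrow> real \<times> (nat \<Rightarrow> real) \<Rightarrow> real" where
  "hyp_dist u v = arcosh (fst u * fst v - ell2_inner (snd u) (snd v))"

lemma ell2_inner_le:
  assumes x: "x \<in> ell2" and y: "y \<in> ell2"
  shows "ell2_inner x y \<le> ell2_norm x * ell2_norm y"
proof -
  have sx: "summable (\<lambda>i. x i * x i)" and sy: "summable (\<lambda>i. y i * y i)"
    using x y by (simp_all add: ell2_def power2_eq_square)
  have partial: "(\<Sum>i<n. \<bar>x i * y i\<bar>) \<le> ell2_norm x * ell2_norm y" for n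
  proof -
    have L2: "L2_set z {..<n} \<le> ell2_norm z" if "summable (\<lambda>i. z i * z i)" for z
      unfolding L2_set_def ell2_norm_def ell2_inner_def power2_eq_square
      by (intro real_sqrt_le_mono sum_le_suminf that) auto
    have "0 \<le> ell2_norm x"
      using sx by (auto simp: ell2_norm_def ell2_inner_def intro: suminf_nonneg)
    then have "L2_set x {..<n} * L2_set y {..<n} \<le> ell2_norm x * ell2_norm y"
      by (intro mult_mono L2 sx sy) auto
    then show ?thesis
      using L2_set_mult_ineq[of x y "{..<n}"] by (simp add: abs_mult)
  qed
  have "summable (\<lambda>i. \<bar>x i * y i\<bar>)"
    by (rule summableI_nonneg_bounded[OF _ partial]) auto
  then have "summable (\<lambda>i. x i * y i)"
    by (rule summable_rabs_cancel)
  moreover have "(\<Sum>i<n. x i * y i) \<le> ell2_norm x * ell2_norm y" for n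
    by (rule order_trans[OF sum_mono partial]) auto
  ultimately show ?thesis
    unfolding ell2_inner_def by (rule suminf_le_const)
qed

lemma hyp_form_ge_1:
  assumes u: "u \<in> hyp_space" and v: "v \<in> hyp_space"
  shows "1 \<le> fst u * fst v - ell2_inner (snd u) (snd v)"
proof -
  define a b where "a = ell2_norm (snd u)" and "b = ell2_norm (snd v)"
  have *: "fst u > 0" "fst v > 0" "(fst u)\<^sup>2 = 1 + a\<^sup>2" "(fst v)\<^sup>2 = 1 + b\<^sup>2"
    "ell2_inner (snd u) (snd v) \<le> a * b"
    using u v ell2_inner_le by (auto simp: hyp_space_def a_def b_def)
  have "(1 + a * b)\<^sup>2 \<le> (1 + a\<^sup>2) * (1 + b\<^sup>2)"
    using zero_le_power2[of "a - b"] by (simp add: power2_eq_square algebra_simps)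
  also have "\<dots> = (fst u * fst v)\<^sup>2"
    by (simp add: * power_mult_distrib)
  finally have "1 + a * b \<le> fst u * fst v"
    by (rule power2_le_imp_le) (use * in auto)
  then show ?thesis
    using * by linarith
qed

lemma hyp_dist_nonneg: "u \<in> hyp_space \<Longrightarrow> v \<in> hyp_space \<Longrightarrow> 0 \<le> hyp_dist u v"
  by (simp add: hyp_dist_def hyp_form_ge_1)

lemma cosh_hyp_dist:
  "u \<in> hyp_space \<Longrightarrow> v \<in> hyp_space \<Longrightarrow>
     cosh (hyp_dist u v) = fst u * fst v - ell2_inner (snd u) (snd v)"
  by (simp add: hyp_dist_def hyp_form_ge_1)

text \<open>Both infima are taken in \<^typ>\<open>ennreal\<close>, so they are \<open>\<infinity>\<close> when no admissible constant
  exists.\<close>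

definition lip_const ::
  "'a set \<Rightarrow> ('a \<Rightarrow> 'a \<Rightarrow> real) \<Rightarrow> ('b \<Rightarrow> 'b \<Rightarrow> real) \<Rightarrow> ('a \<Rightarrow> 'b) \<Rightarrow> ennreal" where
  "lip_const X dX dY f =
     (INF L\<in>{L. 0 \<le> L \<and> (\<forall>x\<in>X. \<forall>y\<in>X. dY (f x) (f y) \<le> L * dX x y)}. ennreal L)"

definition distortion ::
  "'a set \<Rightarrow> ('a \<Rightarrow> 'a \<Rightarrow> real) \<Rightarrow> 'b set \<Rightarrow> ('b \<Rightarrow> 'b \<Rightarrow> real) \<Rightarrow> ennreal" where
  "distortion X dX Y dY =
     (INF D\<in>{D. 0 \<le> D \<and> (\<exists>s>0. \<exists>f\<in>X \<rightarrow> Y. \<forall>x\<in>X. \<forall>y\<in>X.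
        s * dX x y \<le> dY (f x) (f y) \<and> dY (f x) (f y) \<le> s * D * dX x y)}. ennreal D)"

text \<open>The control functions map \<open>[0,\<infinity>)\<close> to itself; their values at negative arguments
  are irrelevant.\<close>

definition coarse_embedding_with ::
  "'a set \<Rightarrow> ('a \<Rightarrow> 'a \<Rightarrow> real) \<Rightarrow> 'b set \<Rightarrow> ('b \<Rightarrow> 'b \<Rightarrow> real) \<Rightarrow>
     (real \<Rightarrow> real) \<Rightarrow> (real \<Rightarrow> real) \<Rightarrow> ('a \<Rightarrow> 'b) \<Rightarrow> bool" where
  "coarse_embedding_with X dX Y dY \<rho> \<omega> f \<longleftrightarrow>
     f \<in> X \<rightarrow> Y \<and>
     \<rho> \<in> {0..} \<rightarrow> {0..} \<and> \<omega> \<in> {0..} \<rightarrow> {0..} \<and>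
     mono_on {0..} \<rho> \<and> mono_on {0..} \<omega> \<and>
     filterlim \<rho> at_top at_top \<and>
     (\<forall>x\<in>X. \<forall>y\<in>X. \<rho> (dX x y) \<le> dY (f x) (f y) \<and> dY (f x) (f y) \<le> \<omega> (dX x y))"

text \<open>Finite subsets of \<open>{1, 2, \<dots>}\<close> are represented by their increasing enumerations.\<close>

definition incr_tuples :: "nat list set" where
  "incr_tuples = {ns. sorted_wrt (<) ns \<and> set ns \<subseteq> {1..}}"

definition tuples_of :: "nat \<Rightarrow> nat list set" where
  "tuples_of h = {ns \<in> incr_tuples. length ns = h}"

definition tuples_upto :: "nat \<Rightarrow> nat list set" where
  "tuples_upto h = {ns \<in> incr_tuples. length ns \<le> h}"

definition tree_edges :: "nat \<Rightarrow> (nat list \<times> nat list) set" where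
  "tree_edges h =
     {(ns, ms). ns \<in> tuples_upto h \<and> ms \<in> tuples_upto h \<and>
        (\<exists>i. ms = ns @ [i] \<or> ns = ms @ [i])}"

definition tree_dist :: "nat \<Rightarrow> nat list \<Rightarrow> nat list \<Rightarrow> real" where
  "tree_dist h ns ms = real (LEAST l. (ns, ms) \<in> tree_edges h ^^ l)"

definition ennreal_powr :: "ennreal \<Rightarrow> real \<Rightarrow> ennreal" where
  "ennreal_powr x p = (if x = \<infinity> then \<infinity> else ennreal (enn2real x powr p))"

text \<open>The innermost infimum is over the empty set, hence \<open>\<infinity>\<close>, unless \<open>ns @ [i]\<close> and
  \<open>ns @ [j]\<close> are increasing.\<close>

definition infrasup_umbel_convex :: "real \<Rightarrow> 'a set \<Rightarrow> ('a \<Rightarrow> 'a \<Rightarrow> real) \<Rightarrow> bool" where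
  "infrasup_umbel_convex p M d \<longleftrightarrow>
     (\<exists>C>0. \<forall>k\<ge>1. \<forall>f\<in>tuples_upto (2 ^ k) \<rightarrow> M.
        (\<Sum>s = 1..k - 1.
           INF ns\<in>tuples_upto (2 ^ k - 2 ^ s).
           INF (i, j)\<in>{(i, j). i \<in> {1..} \<and> j \<in> {1..} \<and> i \<noteq> j}.
           INF (ms, ms')\<in>{(ms, ms'). ms \<in> tuples_of (2 ^ s - 1) \<and> ms' \<in> tuples_of (2 ^ s - 1) \<and>
                 ns @ [i] @ ms \<in> tuples_upto (2 ^ k) \<and> ns @ [j] @ ms' \<in> tuples_upto (2 ^ k)}.
             ennreal (d (f (ns @ [i] @ ms)) (f (ns @ [j] @ ms')) powr p / 2 powr (real s * p)))
        \<le> ennreal (C powr p) * ennreal_powr (lip_const (tuples_upto (2 ^ k)) (tree_dist (2 ^ k)) d f) p)"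

end

theory Submission
  imports Defs "HOL-Library.Nat_Bijection" "HOL-Library.Sublist"
begin

text \<open>
  The countably branching tree embeds into hyperbolic space with
  \<open>cosh d(x, y) = l ^ d\<^sub>T(x, y)\<close> for any \<open>l > 1\<close>: give a vertex of depth \<open>a\<close> the time
  coordinate \<open>l ^ a\<close>, and put \<open>l ^ a \<cdot> b\<^sub>j\<close> on the basis vector of its prefix of length \<open>j\<close>,
  for \<open>1 \<le> j \<le> a\<close>, where \<open>b\<^sub>j\<^sup>2 = l\<^sup>-\<^sup>2\<^sup>(\<^sup>j\<^sup>-\<^sup>1\<^sup>) - l\<^sup>-\<^sup>2\<^sup>j\<close>. The form of two vertices of depths \<open>a\<close>, \<open>b\<close>
  whose paths from the root share \<open>c\<close> edges telescopes to \<open>l ^ (a + b - 2 c)\<close>. For \<open>l = e\<close> the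
  two vertices compared in the \<open>s\<close>-th term of umbel convexity are at hyperbolic distance at
  least \<open>2 ^ (s + 1)\<close>, while edges have constant length; so the umbel inequality bounds the
  partial sums of \<open>\<Sum>\<^sub>s (\<rho>(2 ^ (s + 1)) / 2 ^ s) ^ p\<close>, which dominates the integral by dyadic
  decomposition.
\<close>

section \<open>Embedding of the tree into hyperbolic space\<close>

text \<open>\<open>list_decode\<close> is a bijection from the naturals to all tuples, so each
  \<open>u\<close> owns one coordinate. The factor
  \<open>sqrt (l\<^sup>2 - 1) / l ^ length u\<close> is the weight \<open>b\<^sub>j\<close> for
  \<open>j = length u\<close>.\<close>

definition tree_space_part :: "real \<Rightarrow> nat list \<Rightarrow> nat \<Rightarrow> real" where
  "tree_space_part l x i = (let u = list_decode i in
     if u \<noteq> [] \<and> prefix u x then l ^ length x * (sqrt (l\<^sup>2 - 1) / l ^ length u) else 0)"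

definition tree_to_hyp :: "real \<Rightarrow> nat list \<Rightarrow> real \<times> (nat \<Rightarrow> real)" where
  "tree_to_hyp l x = (l ^ length x, tree_space_part l x)"

lemma finite_nonempty_prefixes: "finite {u. u \<noteq> [] \<and> prefix u x}"
  by (rule finite_subset[of _ "set (prefixes x)"]) auto

text \<open>Telescoping: \<open>z\<close> has one prefix of each length \<open>j\<close> from 1 to
  \<open>length z\<close>, and its weight is
  \<open>1 / l ^ (2 * (j - 1)) - 1 / l ^ (2 * j)\<close>.\<close>

lemma sum_prefix_weights:
  fixes l :: real
  assumes "1 < l"
  shows "(\<Sum>u | u \<noteq> [] \<and> prefix u z. (l\<^sup>2 - 1) / l ^ (2 * length u)) = 1 - 1 / l ^ (2 * length z)"
proof (induction z rule: rev_induct)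
  case (snoc a z)
  have *: "{u. u \<noteq> [] \<and> prefix u (z @ [a])} = insert (z @ [a]) {u. u \<noteq> [] \<and> prefix u z}"
    by auto
  show ?case
    unfolding * using assms finite_nonempty_prefixes
    by (subst sum.insert) (auto simp only: snoc.IH mem_Collect_eq, auto simp: field_simps power2_eq_square)
qed simp

text \<open>The hypothesis makes the two tuples part right after \<open>zs\<close>, their longest
  common prefix.\<close>

lemma common_prefixes:
  assumes "xs = [] \<or> ys = [] \<or> hd xs \<noteq> hd ys"
  shows "prefix u (zs @ xs) \<and> prefix u (zs @ ys) \<longleftrightarrow> prefix u zs"
  using assms by (cases xs; cases ys) (auto simp: prefix_append prefix_Cons)

text \<open>Only codes of nonempty prefixes of \<open>zs\<close> contribute, so the series is a
  finite telescoping sum. The first power in the limit is the product of the time coordinates; the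
  hyperbolic form therefore keeps just \<open>l ^ (length xs + length ys)\<close>, whose exponent is
  the tree distance.\<close>

lemma tree_space_part_sums:
  assumes l: "1 < l" and "xs = [] \<or> ys = [] \<or> hd xs \<noteq> hd ys"
  shows "(\<lambda>i. tree_space_part l (zs @ xs) i * tree_space_part l (zs @ ys) i) sums
    (l ^ (2 * length zs + length xs + length ys) - l ^ (length xs + length ys))"
proof -
  let ?P = "{u. u \<noteq> [] \<and> prefix u zs}"
  let ?g = "\<lambda>i. tree_space_part l (zs @ xs) i * tree_space_part l (zs @ ys) i"
  let ?c = "l ^ (2 * length zs + length xs + length ys)"
  have g: "?g (list_encode u) = (if u \<in> ?P then ?c * ((l\<^sup>2 - 1) / l ^ (2 * length u)) else 0)" for u
  proof -
    have "sqrt (l\<^sup>2 - 1) * sqrt (l\<^sup>2 - 1) = l\<^sup>2 - 1"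
      using l by simp
    then show ?thesis
      using common_prefixes[OF assms(2), of u zs] l
      unfolding mult_2 by (auto simp: tree_space_part_def power_add field_simps)
  qed
  have "?g sums sum ?g (list_encode ` ?P)"
  proof (rule sums_finite)
    fix i assume "i \<notin> list_encode ` ?P"
    then have "list_decode i \<notin> ?P"
      by (metis imageI list_decode_inverse)
    then show "?g i = 0"
      using g[of "list_decode i"] by (auto split: if_splits)
  qed (simp add: finite_nonempty_prefixes)
  also have "sum ?g (list_encode ` ?P) = (\<Sum>u\<in>?P. ?g (list_encode u))"
    by (simp add: sum.reindex inj_list_encode)
  also have "\<dots> = ?c * (\<Sum>u\<in>?P. (l\<^sup>2 - 1) / l ^ (2 * length u))"
    unfolding sum_distrib_left by (rule sum.cong) (auto simp only: g if_True)
  also have "\<dots> = ?c - l ^ (length xs + length ys)"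
    unfolding sum_prefix_weights[OF l] using l by (simp add: field_simps power_add)
  finally show ?thesis .
qed

lemma tree_to_hyp_in_hyp_space:
  assumes "1 < l"
  shows "tree_to_hyp l x \<in> hyp_space"
proof -
  have s: "(\<lambda>i. tree_space_part l x i * tree_space_part l x i) sums (l ^ (2 * length x) - 1)"
    using tree_space_part_sums[OF assms, of "[]" "[]" x] by simp
  moreover have "1 \<le> l ^ (2 * length x)"
    using assms by simp
  ultimately show ?thesis
    using assms sums_summable[OF s]
    by (simp add: tree_to_hyp_def hyp_space_def ell2_def ell2_norm_def ell2_inner_def
        power2_eq_square sums_iff mult_2 power_add)
qed

lemma hyp_dist_tree_to_hyp:
  assumes "1 < l" and "xs = [] \<or> ys = [] \<or> hd xs \<noteq> hd ys"
  shows "hyp_dist (tree_to_hyp l (zs @ xs)) (tree_to_hyp l (zs @ ys))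
    = arcosh (l ^ (length xs + length ys))"
  using tree_space_part_sums[OF assms, of zs]
  unfolding mult_2
  by (simp add: hyp_dist_def tree_to_hyp_def ell2_inner_def sums_iff power_add ac_simps)

text \<open>Dropping the root in \<open>arcosh y = ln (y + sqrt (y\<^sup>2 - 1))\<close> leaves
  \<open>ln y\<close>. Hence for \<open>l = exp 1\<close> the embedding does not shrink tree
  distances.\<close>

lemma arcosh_exp_ge:
  fixes x :: real
  assumes "0 \<le> x"
  shows "x \<le> arcosh (exp x)"
proof -
  have "ln (exp x) \<le> ln (exp x + sqrt ((exp x)\<^sup>2 - 1))"
    using assms by (subst ln_le_cancel_iff) (auto intro!: add_pos_nonneg)
  then show ?thesis
    using assms by (simp add: arcosh_real_def)
qed

section \<open>Paths and Lipschitz constants in the tree\<close>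

lemma tree_edges_sym: "(x, y) \<in> tree_edges h \<Longrightarrow> (y, x) \<in> tree_edges h"
  by (auto simp: tree_edges_def)

lemma tree_edges_to_root: "x \<in> tuples_upto h \<Longrightarrow> (x, []) \<in> (tree_edges h)\<^sup>*"
proof (induction x rule: rev_induct)
  case (snoc a x)
  then have "x \<in> tuples_upto h"
    by (auto simp: tuples_upto_def incr_tuples_def sorted_wrt_append)
  moreover from this snoc.prems have "(x @ [a], x) \<in> tree_edges h"
    by (auto simp: tree_edges_def)
  ultimately show ?case
    using snoc.IH by (meson converse_rtrancl_into_rtrancl)
qed simp

text \<open>Any two vertices are joined through the root, so the \<open>LEAST\<close> in
  \<open>tree_dist\<close> is attained.\<close>

lemma tree_dist_path:
  assumes "x \<in> tuples_upto h" "y \<in> tuples_upto h"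
  obtains n where "(x, y) \<in> tree_edges h ^^ n" "tree_dist h x y = real n"
proof -
  have "(y, x) \<in> (tree_edges h)\<^sup>*" if "(x, y) \<in> (tree_edges h)\<^sup>*" for x y
    using that by (induction) (auto intro: tree_edges_sym converse_rtrancl_into_rtrancl)
  then have "(x, y) \<in> (tree_edges h)\<^sup>*"
    using assms tree_edges_to_root by (meson rtrancl_trans)
  then obtain n where "(x, y) \<in> tree_edges h ^^ n"
    using rtrancl_imp_relpow by blast
  then have "(x, y) \<in> tree_edges h ^^ (LEAST n. (x, y) \<in> tree_edges h ^^ n)"
    by (rule LeastI)
  then show ?thesis
    by (rule that) (simp add: tree_dist_def)
qed

text \<open>The triangle inequality along a shortest path adds up the edge bounds, so it suffices to
  control edges.\<close>

lemma lip_const_tree_le: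
  assumes "Metric_space Y dY" and g: "g \<in> tuples_upto h \<rightarrow> Y" and "0 \<le> L"
    and L: "\<And>x y. (x, y) \<in> tree_edges h \<Longrightarrow> dY (g x) (g y) \<le> L"
  shows "lip_const (tuples_upto h) (tree_dist h) dY g \<le> ennreal L"
proof -
  interpret Metric_space Y dY by fact
  have path: "dY (g x) (g y) \<le> L * real n"
    if "(x, y) \<in> tree_edges h ^^ n" "x \<in> tuples_upto h" for n x y
    using that
  proof (induction n arbitrary: y)
    case 0
    then have "g x \<in> Y" "y = x"
      using g by auto
    then show ?case by simp
  next
    case (Suc n)
    then obtain z where z: "(x, z) \<in> tree_edges h ^^ n" "(z, y) \<in> tree_edges h"
      by auto
    then have "g x \<in> Y" "g z \<in> Y" "g y \<in> Y"
      using g Suc.prems by (auto simp: tree_edges_def)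
    then have "dY (g x) (g y) \<le> dY (g x) (g z) + dY (g z) (g y)"
      by (rule triangle)
    then show ?case
      using Suc.IH[OF z(1)] L[OF z(2)] Suc.prems by (simp add: algebra_simps)
  qed
  have "dY (g x) (g y) \<le> L * tree_dist h x y"
    if "x \<in> tuples_upto h" "y \<in> tuples_upto h" for x y
    using tree_dist_path[OF that] path that by metis
  then show ?thesis
    unfolding lip_const_def using \<open>0 \<le> L\<close> by (intro INF_lower) auto
qed

lemma ennreal_powr_le:
  assumes "x \<le> ennreal L" "0 \<le> L" "0 < p"
  shows "ennreal_powr x p \<le> ennreal (L powr p)"
proof -
  have "x \<noteq> \<infinity>"
    using assms(1) by (auto simp: top_unique)
  moreover have "enn2real x \<le> L"
    using enn2real_mono[OF assms(1)] assms(2) by simp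
  ultimately show ?thesis
    using assms by (auto simp: ennreal_powr_def intro!: ennreal_leI powr_mono2)
qed

section \<open>Umbel inequality for the embedded trees\<close>

text \<open>The umbel inequality on the tree of height \<open>2 ^ k\<close> bounds the partial sums
  uniformly in \<open>k\<close>, since neither the convexity constant nor the edge bound depends on
  the height.\<close>

lemma coarse_embedding_dyadic_summable:
  assumes p: "0 < p" and Y: "Metric_space Y dY" and conv: "infrasup_umbel_convex p Y dY"
    and emb: "coarse_embedding_with hyp_space hyp_dist Y dY \<rho> \<omega> f"
  shows "summable (\<lambda>n. (\<rho> (2 * 2 ^ n) / 2 ^ n) powr p)"
proof -
  define a where "a n = (\<rho> (2 * 2 ^ n) / 2 ^ n) powr p" for n :: nat
  define g where "g = f \<circ> tree_to_hyp (exp 1)"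
  \<comment> \<open>Neighbours in the tree embed at distance \<open>arcosh (exp 1)\<close>, whatever
    the height.\<close>
  define L where "L = \<omega> (arcosh (exp 1))"
  have f: "f \<in> hyp_space \<rightarrow> Y"
    and lower: "\<And>x y. x \<in> hyp_space \<Longrightarrow> y \<in> hyp_space \<Longrightarrow> \<rho> (hyp_dist x y) \<le> dY (f x) (f y)"
    and upper: "\<And>x y. x \<in> hyp_space \<Longrightarrow> y \<in> hyp_space \<Longrightarrow> dY (f x) (f y) \<le> \<omega> (hyp_dist x y)"
    and \<rho>0: "\<And>t. 0 \<le> t \<Longrightarrow> 0 \<le> \<rho> t" and \<omega>0: "\<And>t. 0 \<le> t \<Longrightarrow> 0 \<le> \<omega> t"
    and \<rho>_mono: "\<And>s t. 0 \<le> s \<Longrightarrow> s \<le> t \<Longrightarrow> \<rho> s \<le> \<rho> t"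
    using emb by (auto simp: coarse_embedding_with_def mono_on_def Pi_iff)
  have l: "1 < exp (1::real)" by simp
  note in_hyp = tree_to_hyp_in_hyp_space[OF l]
  have g: "g \<in> A \<rightarrow> Y" for A
    using f in_hyp by (auto simp: g_def)
  have L0: "0 \<le> L"
    unfolding L_def by (intro \<omega>0) simp
  have edge: "dY (g x) (g y) \<le> L" if "(x, y) \<in> tree_edges h" for h x y
  proof -
    have "hyp_dist (tree_to_hyp (exp 1) x) (tree_to_hyp (exp 1) y) = arcosh (exp 1)"
      using that hyp_dist_tree_to_hyp[OF l, of "[]" _ x] hyp_dist_tree_to_hyp[OF l, of _ "[]" y]
      by (fastforce simp: tree_edges_def)
    then show ?thesis
      using upper[OF in_hyp in_hyp, of x y] by (simp add: g_def L_def)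
  qed
  have fork: "\<rho> (2 * 2 ^ s) \<le> dY (g (ns @ [i] @ ms)) (g (ns @ [j] @ ms'))"
    if "i \<noteq> j" "length ms = 2 ^ s - 1" "length ms' = 2 ^ s - 1" for s ns i j ms ms'
  proof -
    let ?d = "hyp_dist (tree_to_hyp (exp 1) (ns @ [i] @ ms)) (tree_to_hyp (exp 1) (ns @ [j] @ ms'))"
    \<comment> \<open>Below the common prefix \<open>ns\<close> each branch has
      \<open>1 + (2 ^ s - 1) = 2 ^ s\<close> entries.\<close>
    have len: "length ([i] @ ms) + length ([j] @ ms') = 2 * 2 ^ s"
      using that by simp
    have "?d = arcosh (exp 1 ^ (2 * 2 ^ s))"
      using that hyp_dist_tree_to_hyp[OF l, of "[i] @ ms" "[j] @ ms'" ns] unfolding len by simp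
    also have "\<dots> = arcosh (exp (2 * 2 ^ s))"
      by (simp flip: exp_of_nat_mult)
    finally have "2 * 2 ^ s \<le> ?d"
      using arcosh_exp_ge[of "2 * 2 ^ s"] by simp
    then have "\<rho> (2 * 2 ^ s) \<le> \<rho> ?d"
      by (intro \<rho>_mono) auto
    also have "\<dots> \<le> dY (f (tree_to_hyp (exp 1) (ns @ [i] @ ms))) (f (tree_to_hyp (exp 1) (ns @ [j] @ ms')))"
      by (intro lower in_hyp)
    finally show ?thesis
      by (simp add: g_def)
  qed
  have a_le: "a s \<le> dY (g (ns @ [i] @ ms)) (g (ns @ [j] @ ms')) powr p / 2 powr (real s * p)"
    if "i \<noteq> j" "length ms = 2 ^ s - 1" "length ms' = 2 ^ s - 1" for s ns i j ms ms'
  proof -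
    have "a s = \<rho> (2 * 2 ^ s) powr p / 2 powr (real s * p)"
      using \<rho>0[of "2 * 2 ^ s"] by (simp add: a_def powr_divide powr_powr flip: powr_realpow)
    also have "\<dots> \<le> dY (g (ns @ [i] @ ms)) (g (ns @ [j] @ ms')) powr p / 2 powr (real s * p)"
      using p \<rho>0[of "2 * 2 ^ s"] fork[OF that] by (intro divide_right_mono powr_mono2) auto
    finally show ?thesis .
  qed
  obtain C where C: "\<And>k h. 1 \<le> k \<Longrightarrow> h \<in> tuples_upto (2 ^ k) \<rightarrow> Y \<Longrightarrow>
        (\<Sum>s = 1..k - 1.
           INF ns\<in>tuples_upto (2 ^ k - 2 ^ s).
           INF (i, j)\<in>{(i, j). i \<in> {1..} \<and> j \<in> {1..} \<and> i \<noteq> j}.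
           INF (ms, ms')\<in>{(ms, ms'). ms \<in> tuples_of (2 ^ s - 1) \<and> ms' \<in> tuples_of (2 ^ s - 1) \<and>
                 ns @ [i] @ ms \<in> tuples_upto (2 ^ k) \<and> ns @ [j] @ ms' \<in> tuples_upto (2 ^ k)}.
             ennreal (dY (h (ns @ [i] @ ms)) (h (ns @ [j] @ ms')) powr p / 2 powr (real s * p)))
        \<le> ennreal (C powr p) * ennreal_powr (lip_const (tuples_upto (2 ^ k)) (tree_dist (2 ^ k)) dY h) p"
    using conv unfolding infrasup_umbel_convex_def by blast
  have bound: "(\<Sum>s = 1..k - 1. a s) \<le> C powr p * L powr p" if "1 \<le> k" for k
  proof -
    have "ennreal (\<Sum>s = 1..k - 1. a s) = (\<Sum>s = 1..k - 1. ennreal (a s))"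
      by (simp add: a_def sum_ennreal)
    \<comment> \<open>\<open>a s\<close> is a lower bound for every admissible term and hence for
      the nested infima; empty ones are \<open>\<infinity>\<close>.\<close>
    also have "\<dots> \<le> ennreal (C powr p) *
        ennreal_powr (lip_const (tuples_upto (2 ^ k)) (tree_dist (2 ^ k)) dY g) p"
      by (rule order_trans[OF sum_mono C[OF that g]])
        (auto intro!: INF_greatest ennreal_leI a_le simp: tuples_of_def simp del: append.simps)
    also have "\<dots> \<le> ennreal (C powr p) * ennreal (L powr p)"
      by (intro mult_left_mono ennreal_powr_le lip_const_tree_le[OF Y] g L0 p edge) auto
    finally show ?thesis
      by (simp flip: ennreal_mult')
  qed
  have "(\<Sum>n<k. a n) \<le> a 0 + C powr p * L powr p" for k
  proof -
    have "(\<Sum>n<k. a n) \<le> (\<Sum>n<Suc k. a n)"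
      by (simp add: a_def)
    \<comment> \<open>The umbel sum starts at \<open>s = 1\<close>, so \<open>a 0\<close> is split
      off; height \<open>2 ^ Suc k\<close> covers the indices 1 to \<open>k\<close>.\<close>
    also have "{..<Suc k} = insert 0 {1..Suc k - 1}"
      by auto
    also have "sum a \<dots> \<le> a 0 + C powr p * L powr p"
      using bound[of "Suc k"] by (subst sum.insert) auto
    finally show ?thesis .
  qed
  then have "summable a"
    by (intro summableI_nonneg_bounded) (auto simp: a_def)
  then show ?thesis
    unfolding a_def .
qed

section \<open>Dyadic comparison of the integral with the series\<close>

text \<open>On the interval from \<open>2 ^ n\<close> to \<open>2 * 2 ^ n\<close>, monotonicity
  bounds the integrand by the \<open>n\<close>-th term of the series divided by
  \<open>2 ^ n\<close>, which is the length of the interval.\<close>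

lemma nn_integral_dyadic_finite:
  fixes \<rho> :: "real \<Rightarrow> real"
  assumes p: "0 < p" and \<rho>0: "\<And>t. 1 \<le> t \<Longrightarrow> 0 \<le> \<rho> t"
    and mono: "\<And>s t. 1 \<le> s \<Longrightarrow> s \<le> t \<Longrightarrow> \<rho> s \<le> \<rho> t"
    and summ: "summable (\<lambda>n. (\<rho> (2 * 2 ^ n) / 2 ^ n) powr p)"
  shows "(\<integral>\<^sup>+t\<in>{1..}. ennreal ((\<rho> t / t) powr p / t) \<partial>lborel) < \<infinity>"
proof -
  define a where "a n = (\<rho> (2 * 2 ^ n) / 2 ^ n) powr p" for n :: nat
  have pointwise: "ennreal ((\<rho> t / t) powr p / t) * indicator {1..} t
      \<le> (\<Sum>n. ennreal (a n / 2 ^ n) * indicator {2 ^ n..2 * 2 ^ n} t)" (is "?l \<le> suminf ?F")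
    for t :: real
  proof (cases "1 \<le> t")
    case True
    then obtain n where "2 ^ n \<le> nat \<lfloor>t\<rfloor>" "nat \<lfloor>t\<rfloor> < 2 ^ (n + 1)"
      using ex_power_ivl1[of 2 "nat \<lfloor>t\<rfloor>"] by (auto simp: le_nat_iff)
    then have "2 ^ n \<le> \<lfloor>t\<rfloor>" "\<lfloor>t\<rfloor> < 2 * 2 ^ n"
      using True by (simp_all add: le_nat_iff nat_less_iff)
    then have n: "2 ^ n \<le> t" "t < 2 * 2 ^ n"
      by (simp_all add: le_floor_iff floor_less_iff)
    have "0 < (2::real) ^ n"
      by simp
    then have "(\<rho> t / t) powr p / t \<le> a n / 2 ^ n"
      unfolding a_def using n True p \<rho>0[of t] mono[of t "2 * 2 ^ n"]
      by (intro frac_le powr_mono2) auto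
    then have "?l \<le> ?F n"
      using n True by (simp add: ennreal_leI)
    also have "\<dots> \<le> suminf ?F"
      using sum_le_suminf[of ?F "{n}"] by (simp del: indicator_simps sum_mult_indicator)
    finally show ?thesis .
  qed simp
  have "(\<integral>\<^sup>+t\<in>{1..}. ennreal ((\<rho> t / t) powr p / t) \<partial>lborel)
      \<le> (\<integral>\<^sup>+t. (\<Sum>n. ennreal (a n / 2 ^ n) * indicator {2 ^ n..2 * 2 ^ n :: real} t) \<partial>lborel)"
    by (intro nn_integral_mono pointwise)
  also have "\<dots> = (\<Sum>n. \<integral>\<^sup>+t. ennreal (a n / 2 ^ n) * indicator {2 ^ n..2 * 2 ^ n :: real} t \<partial>lborel)"
    by (intro nn_integral_suminf) auto
  also have "\<dots> = (\<Sum>n. ennreal (a n))"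
  proof (rule suminf_cong)
    fix n
    have "(\<integral>\<^sup>+t. ennreal (a n / 2 ^ n) * indicator {2 ^ n..2 * 2 ^ n :: real} t \<partial>lborel)
        = ennreal (a n / 2 ^ n) * ennreal (2 ^ n)"
      by (subst nn_integral_cmult_indicator) auto
    also have "\<dots> = ennreal (a n / 2 ^ n * 2 ^ n)"
      by (rule ennreal_mult'[symmetric]) (simp add: a_def)
    finally show "(\<integral>\<^sup>+t. ennreal (a n / 2 ^ n) * indicator {2 ^ n..2 * 2 ^ n :: real} t \<partial>lborel)
        = ennreal (a n)"
      by simp
  qed
  also have "\<dots> = ennreal (suminf a)"
    by (rule suminf_ennreal2) (use summ in \<open>simp_all add: a_def[abs_def]\<close>)
  also have "\<dots> < \<infinity>"
    by simp
  finally show ?thesis .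
qed

section \<open>Compression rate and distortion\<close>

theorem corollary23:
  fixes Y :: "'a set" and dY :: "'a \<Rightarrow> 'a \<Rightarrow> real" and p :: real
  assumes "0 < p"
    and "Metric_space Y dY"
    and "infrasup_umbel_convex p Y dY"
  shows "(\<forall>f \<rho> \<omega>. coarse_embedding_with hyp_space hyp_dist Y dY \<rho> \<omega> f \<longrightarrow>
            (\<integral>\<^sup>+t\<in>{1..}. ennreal ((\<rho> t / t) powr p / t) \<partial>lborel) < \<infinity>)
         \<and> distortion hyp_space hyp_dist Y dY = \<infinity>"
proof (intro conjI allI impI)
  fix f \<rho> \<omega>
  assume emb: "coarse_embedding_with hyp_space hyp_dist Y dY \<rho> \<omega> f"
  then show "(\<integral>\<^sup>+t\<in>{1..}. ennreal ((\<rho> t / t) powr p / t) \<partial>lborel) < \<infinity>"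
    using coarse_embedding_dyadic_summable[OF assms emb] assms(1)
    by (intro nn_integral_dyadic_finite) (auto simp: coarse_embedding_with_def mono_on_def Pi_iff)
next
  \<comment> \<open>An admissible \<open>D\<close> would make \<open>f\<close> a coarse embedding
    with linear control functions. Its dyadic series has the constant positive term
    \<open>(s * 2) powr p\<close> and so diverges.\<close>
  have False if D: "0 \<le> D" and s: "0 < s" and f: "f \<in> hyp_space \<rightarrow> Y"
    and bounds: "\<forall>x\<in>hyp_space. \<forall>y\<in>hyp_space.
      s * hyp_dist x y \<le> dY (f x) (f y) \<and> dY (f x) (f y) \<le> s * D * hyp_dist x y" for D s f
  proof -
    have "filterlim (\<lambda>t. s * t) at_top at_top"
      using s by (intro filterlim_tendsto_pos_mult_at_top[OF tendsto_const]) (auto simp: filterlim_ident)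
    then have "coarse_embedding_with hyp_space hyp_dist Y dY (\<lambda>t. s * t) (\<lambda>t. s * D * t) f"
      using D s f bounds
      by (auto simp: coarse_embedding_with_def mono_on_def intro!: mult_left_mono)
    from coarse_embedding_dyadic_summable[OF assms this]
    have "summable (\<lambda>n::nat. (s * 2) powr p)"
      by simp
    then show False
      using s by (simp add: summable_const_iff)
  qed
  then have none: "{D. 0 \<le> D \<and> (\<exists>s>0. \<exists>f\<in>hyp_space \<rightarrow> Y. \<forall>x\<in>hyp_space. \<forall>y\<in>hyp_space.
      s * hyp_dist x y \<le> dY (f x) (f y) \<and> dY (f x) (f y) \<le> s * D * hyp_dist x y)} = {}"
    by blast
  show "distortion hyp_space hyp_dist Y dY = \<infinity>"
    unfolding distortion_def none by simp
qed

end
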